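(* Let $(H,\langle -,-,-\rangle,\alpha)$ be a Hom-heap and let $e\in H$. If $\alpha(e)=e$, then the retract of $H$ at $e$, i.e. $(H,\bullet_{e},\alpha)$ with $a\bullet_{e}b:=\langle a,e,b\rangle$ for all $a,b\in H$, is a Hom-group.
   Context: A Hom-heap $(H,\langle -,-,-\rangle,\alpha)$ is a set $H$ with a bijective map $\alpha:H\to H$ and a ternary operation $\langle -,-,-\rangle:H\times H\times H\to H$ such that for all $e,f,x,y,z\in H$: (i) $\langle x,x,y\rangle=\alpha(y)=\langle y,x,x\rangle$; (ii) $\langle \alpha(e),\alpha(f),\langle x,y,z\rangle\rangle=\langle\langle e,f,x\rangle,\alpha(y),\alpha(z)\rangle$; (iii) $\alpha\langle x,y,z\rangle=\langle\alpha(x),\alpha(y),\alpha(z)\rangle$. A Hom-group (always meaning regular Hom-group) is a set $G$ with a distinguished element $e\in G$ (the unit), a bijective map $\alpha:G\to G$ and a binary operation $\bullet:G\times G\to G$ such that: (i) $\alpha(a)\bullet(b\bullet c)=(a\bullet b)\bullet\alpha(c)$ for all $a,b,c\in G$; (ii) $\alpha(a\bullet b)=\alpha(a)\bullet\alpha(b)$ for all $a,b\in G$; (iii) $a\bullet e=e\bullet a=\alpha(a)$ for all $a\in G$; (iv) for every $a\in G$ there exists $a^{-1}\in G$ with $a\bullet a^{-1}=a^{-1}\bullet a=e$. *)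

theory Defs
  imports Main
begin

locale hom_heap =
  fixes H :: "'a set"
    and br :: "'a \<Rightarrow> 'a \<Rightarrow> 'a \<Rightarrow> 'a"  ("\<langle>_,/ _,/ _\<rangle>")
    and \<alpha> :: "'a \<Rightarrow> 'a"
  assumes bij_alpha: "bij_betw \<alpha> H H"
    and br_closed: "\<lbrakk>x \<in> H; y \<in> H; z \<in> H\<rbrakk> \<Longrightarrow> \<langle>x, y, z\<rangle> \<in> H"
    and malcev_left: "\<lbrakk>x \<in> H; y \<in> H\<rbrakk> \<Longrightarrow> \<langle>x, x, y\<rangle> = \<alpha> y"
    and malcev_right: "\<lbrakk>x \<in> H; y \<in> H\<rbrakk> \<Longrightarrow> \<langle>y, x, x\<rangle> = \<alpha> y"
    and hom_assoc: "\<lbrakk>e \<in> H; f \<in> H; x \<in> H; y \<in> H; z \<in> H\<rbrakk> \<Longrightarrow>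
      \<langle>\<alpha> e, \<alpha> f, \<langle>x, y, z\<rangle>\<rangle> = \<langle>\<langle>e, f, x\<rangle>, \<alpha> y, \<alpha> z\<rangle>"
    and alpha_br: "\<lbrakk>x \<in> H; y \<in> H; z \<in> H\<rbrakk> \<Longrightarrow> \<alpha> \<langle>x, y, z\<rangle> = \<langle>\<alpha> x, \<alpha> y, \<alpha> z\<rangle>"

text \<open>Regular Hom-groups: the twisting map is bijective. The unit is part of the structure.\<close>

locale hom_group =
  fixes G :: "'a set"
    and mult :: "'a \<Rightarrow> 'a \<Rightarrow> 'a"  (infixl "\<bullet>" 70)
    and unit :: 'a
    and \<alpha> :: "'a \<Rightarrow> 'a"
  assumes bij_alpha: "bij_betw \<alpha> G G"
    and unit_closed: "unit \<in> G"
    and mult_closed: "\<lbrakk>a \<in> G; b \<in> G\<rbrakk> \<Longrightarrow> a \<bullet> b \<in> G"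
    and hom_assoc: "\<lbrakk>a \<in> G; b \<in> G; c \<in> G\<rbrakk> \<Longrightarrow> \<alpha> a \<bullet> (b \<bullet> c) = (a \<bullet> b) \<bullet> \<alpha> c"
    and alpha_mult: "\<lbrakk>a \<in> G; b \<in> G\<rbrakk> \<Longrightarrow> \<alpha> (a \<bullet> b) = \<alpha> a \<bullet> \<alpha> b"
    and right_unit: "a \<in> G \<Longrightarrow> a \<bullet> unit = \<alpha> a"
    and left_unit: "a \<in> G \<Longrightarrow> unit \<bullet> a = \<alpha> a"
    and inverse_ex: "a \<in> G \<Longrightarrow> \<exists>b\<in>G. a \<bullet> b = unit \<and> b \<bullet> a = unit"

definition retract_op :: "('a \<Rightarrow> 'a \<Rightarrow> 'a \<Rightarrow> 'a) \<Rightarrow> 'a \<Rightarrow> 'a \<Rightarrow> 'a \<Rightarrow> 'a"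
  where "retract_op br e a b = br a e b"

end

theory Submission
  imports Defs
begin

text \<open>Since \<alpha> fixes \<open>e\<close>, any \<open>e\<close> may be read as
  \<open>\<alpha> e\<close>: the heap law with \<open>e\<close> in both middle slots is
  Hom-associativity, and the Malcev identities are the unit laws. Only inverses need a
  computation.\<close>

theorem theorem3p9:
  fixes H :: "'a set"
    and br :: "'a \<Rightarrow> 'a \<Rightarrow> 'a \<Rightarrow> 'a"
    and \<alpha> :: "'a \<Rightarrow> 'a"
    and e :: 'a
  assumes "hom_heap H br \<alpha>"
    and "e \<in> H"
    and "\<alpha> e = e"
  shows "hom_group H (retract_op br e) e \<alpha>"
proof -
  interpret hom_heap H br \<alpha> by fact
  note e = \<open>e \<in> H\<close> \<open>\<alpha> e = e\<close>
  show ?thesis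
  proof (unfold_locales, unfold retract_op_def)
    show "bij_betw \<alpha> H H" by (rule bij_alpha)
    show "e \<in> H" by (rule e)
  next
    fix a b assume "a \<in> H" "b \<in> H"
    then show "br a e b \<in> H" using e by (simp add: br_closed)
  next
    fix a b c assume "a \<in> H" "b \<in> H" "c \<in> H"
    then show "br (\<alpha> a) e (br b e c) = br (br a e b) e (\<alpha> c)"
      using hom_assoc[of a e b e c] e by simp
  next
    fix a b assume "a \<in> H" "b \<in> H"
    then show "\<alpha> (br a e b) = br (\<alpha> a) e (\<alpha> b)"
      using e by (simp add: alpha_br)
  next
    fix a assume "a \<in> H"
    then show "br a e e = \<alpha> a" using e by (simp add: malcev_right)
  next
    fix a assume "a \<in> H"
    then show "br e e a = \<alpha> a" using e by (simp add: malcev_left)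
  next
    fix a assume "a \<in> H"
    \<comment> \<open>\<open>hom_assoc\<close> rebrackets only around entries of the form \<alpha>
      x, so \<open>a\<close> is pulled back along \<alpha>.\<close>
    then obtain c where c: "c \<in> H" and a: "a = \<alpha> c"
      using bij_alpha by (auto simp: bij_betw_def)
    txt \<open>The inverse of \<open>\<alpha> c\<close> is \<open>\<langle>e, c, e\<rangle>\<close>, not \<open>\<langle>e, \<alpha> c, e\<rangle>\<close>.\<close>
    show "\<exists>b\<in>H. br a e b = e \<and> br b e a = e"
    proof (intro bexI conjI)
      show "br e c e \<in> H" using c e by (simp add: br_closed)
      \<comment> \<open>Rebracketing gives \<open>br (br c e e) (\<alpha> c) e\<close>, that is
        \<open>br (\<alpha> c) (\<alpha> c) e\<close>, which collapses to
        \<open>\<alpha> e\<close>.\<close>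
      show "br a e (br e c e) = e"
        using hom_assoc[of c e e c e] c e \<open>a \<in> H\<close>
        by (simp add: a malcev_left malcev_right)
      \<comment> \<open>Mirror image: rebracketed to \<open>br e (\<alpha> c) (br e e c)\<close>,
        whose last two entries cancel.\<close>
      show "br (br e c e) e a = e"
        using hom_assoc[of e c e e c] c e \<open>a \<in> H\<close>
        by (simp add: a malcev_left malcev_right)
    qed
  qed
qed

end
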